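(* Let $L\geq 1$ be a fixed real number. Then there are only finitely many numbers with the Lehmer property in the set $$ \left\{\frac{g^{n}-1}{g-1}\ \bigg|\ g,n\in\mathbb{N},\ g\geq 2,\ \nu_{2}(g)+\nu_{2}(g+1)\leq L \right\}, $$ and all of them are effectively computable.
   Context: $\mathbb{N}$ denotes the set of positive integers. $\varphi$ is Euler's totient function. A composite positive integer $N$ is said to have the Lehmer property (or to be a Lehmer number) if $\varphi(N)$ divides $N-1$. For a positive integer $m$, $\nu_2(m)$ denotes the $2$-adic valuation of $m$, that is, the exponent of $2$ in the prime factorization of $m$. "Effectively computable" means that there are effective (computable) upper bounds, in terms of $L$ (more precisely of $\lfloor L\rfloor$, on which alone the set depends), for all $g$ and $n$ such that $\frac{g^n-1}{g-1}$ belongs to the set and has the Lehmer property. *)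

theory Defs
  imports Complex_Main "HOL-Number_Theory.Number_Theory"
begin

definition lehmer :: "nat \<Rightarrow> bool" where
  "lehmer N \<longleftrightarrow> N > 1 \<and> \<not> prime N \<and> totient N dvd N - 1"

(* The division and both subtractions are exact for g \<ge> 2, since g - 1 divides g ^ n - 1. *)
definition repunit :: "nat \<Rightarrow> nat \<Rightarrow> nat" where
  "repunit g n = (g ^ n - 1) div (g - 1)"

definition repunit_set :: "real \<Rightarrow> nat set" where
  "repunit_set L = {repunit g n | g n. g \<ge> 2 \<and> n \<ge> 1 \<and>
     real (multiplicity 2 g + multiplicity 2 (g + 1)) \<le> L}"

(* Kleene's general recursive functions: the least class of total functions of several
   arguments that contains the basic functions and is closed under composition, primitive
   recursion, and minimization of regular functions (those that have a zero for every choice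
   of the parameters). By the normal form theorem these are exactly the total computable
   functions. A function of k arguments is encoded as a function on lists, of which only the
   values at lists of length k are meaningful. *)
inductive general_recursive :: "nat \<Rightarrow> (nat list \<Rightarrow> nat) \<Rightarrow> bool" where
  zero: "general_recursive k (\<lambda>xs. 0)"
| succ: "general_recursive 1 (\<lambda>xs. Suc (xs ! 0))"
| proj: "i < k \<Longrightarrow> general_recursive k (\<lambda>xs. xs ! i)"
| comp: "general_recursive (length gs) f \<Longrightarrow> \<forall>g \<in> set gs. general_recursive k g \<Longrightarrow>
    general_recursive k (\<lambda>xs. f (map (\<lambda>g. g xs) gs))"
| prim_rec: "general_recursive k f \<Longrightarrow> general_recursive (Suc (Suc k)) h \<Longrightarrow>
    general_recursive (Suc k)
      (\<lambda>xs. rec_nat (f (tl xs)) (\<lambda>m r. h (m # r # tl xs)) (hd xs))"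
| minimize: "general_recursive (Suc k) f \<Longrightarrow>
    \<forall>xs. length xs = k \<longrightarrow> (\<exists>m. f (m # xs) = 0) \<Longrightarrow>
    general_recursive k (\<lambda>xs. LEAST m. f (m # xs) = 0)"

definition computable :: "(nat \<Rightarrow> nat) \<Rightarrow> bool" where
  "computable f \<longleftrightarrow> (\<exists>F. general_recursive 1 F \<and> (\<forall>x. f x = F [x]))"

end

theory Submission
  imports Defs "HOL-Computational_Algebra.Squarefree" "HOL-Analysis.Infinite_Products"
begin

text \<open>A Lehmer number \<open>N\<close> with \<open>K\<close> prime factors is squarefree, satisfies \<open>2 ^ K dvd N - 1\<close>, and
  has \<open>4 N \<le> 4 ^ 2 ^ K\<close> by an argument of Pomerance. For \<open>N = (g ^ n - 1) / (g - 1)\<close> with \<open>g\<close> even this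
  suffices, as \<open>2 ^ K\<close> divides \<open>g\<close>. For \<open>g\<close> odd one gets \<open>2 ^ K \<le> c (n - 1)\<close> with
  \<open>c = 2 ^ \<nu>\<^sub>2(g + 1)\<close>, so \<open>g \<le> 4 ^ c\<close>. Moreover the prime factors of \<open>N\<close> are then so sparse that
  for every proper divisor \<open>u\<close> of \<open>n\<close> some prime factor of \<open>N\<close> prime to \<open>(g ^ u - 1) / (g - 1)\<close> is
  bounded in terms of \<open>c\<close> and \<open>u\<close>; the order of \<open>g\<close> modulo it is a divisor \<open>d\<close> of \<open>n\<close> not dividing \<open>u\<close>.
  Taking \<open>u = 1\<close> bounds some prime factor \<open>q\<close> of \<open>n\<close>, and iterating \<open>u \<mapsto> lcm u d\<close> reaches \<open>n\<close>. Each step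
  adds a prime factor of \<open>N\<close> modulo which the order of \<open>g\<close> is divisible by \<open>q\<close>. There are fewer than
  \<open>g ^ q\<close> of those, since each contributes a factor \<open>q\<close> to \<open>\<phi>(N)\<close> and the power of \<open>q\<close> in \<open>N - 1\<close>
  is at most \<open>g ^ q\<close>.\<close>

subsection \<open>Lehmer numbers\<close>

lemma lehmer_coprime_totient:
  assumes "lehmer N" shows "coprime N (totient N)"
proof -
  have "N > 1" "totient N dvd N - 1" using assms by (auto simp: lehmer_def)
  then have "coprime N (N - 1)" by (metis coprime_diff_one_right_nat gr_implies_not_zero not_gr_zero)
  with \<open>totient N dvd N - 1\<close> show ?thesis by (meson coprime_divisors dvd_refl)
qed

text \<open>A repeated prime \<open>p\<close> would divide both \<open>N\<close> and
  \<open>totient N\<close>, which are coprime because \<open>totient N\<close> divides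
  \<open>N - 1\<close>.\<close>

lemma lehmer_squarefree:
  assumes "lehmer N" shows "squarefree N"
proof (rule ccontr)
  assume "\<not> squarefree N"
  moreover have "N \<noteq> 0" using assms by (simp add: lehmer_def)
  ultimately obtain p where p: "prime p" "p\<^sup>2 dvd N"
    by (auto simp: squarefree_factorial_semiring)
  have "totient (p\<^sup>2) dvd totient N" using p by (intro totient_dvd)
  moreover have "p dvd totient (p\<^sup>2)" using p by (simp add: totient_prime_power)
  ultimately have "p dvd totient N" by (rule dvd_trans[rotated])
  moreover have "p dvd N" using p by (metis dvd_mult_left power2_eq_square)
  ultimately show False
    using lehmer_coprime_totient[OF assms] p(1) by (metis coprime_common_divisor not_prime_unit)
qed

lemma lehmer_not_dvd_prime_minus_1:
  assumes "lehmer N" "prime p" "prime q" "p dvd N" "q dvd N"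
  shows "\<not> q dvd p - 1"
proof
  assume "q dvd p - 1"
  then have "q dvd totient p" using assms by (simp add: totient_prime)
  then have "q dvd totient N" using totient_dvd[OF assms(4)] by (rule dvd_trans)
  then show False
    using lehmer_coprime_totient[OF assms(1)] assms by (metis coprime_common_divisor not_prime_unit)
qed

lemma lehmer_odd:
  assumes "lehmer N" shows "odd N"
proof
  assume "even N"
  have "N \<noteq> 2" using assms by (auto simp: lehmer_def)
  then have "N > 2" using assms by (auto simp: lehmer_def)
  then have "even (totient N)" by (rule totient_even)
  with \<open>even N\<close> show False
    using lehmer_coprime_totient[OF assms] by (metis coprime_common_divisor odd_one)
qed

lemma squarefree_prod_prime_factors:
  fixes N :: nat assumes "squarefree N" shows "\<Prod>(prime_factors N) = N"
proof -
  have N: "N \<noteq> 0" using assms by (metis not_squarefree_0)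
  have "N = (\<Prod>p\<in>prime_factors N. p ^ multiplicity p N)"
    using N by (simp add: prime_factorization_nat)
  also have "\<dots> = \<Prod>(prime_factors N)"
  proof (intro prod.cong refl)
    fix p assume "p \<in> prime_factors N"
    then have "multiplicity p N = 1"
      using assms squarefree_factorial_semiring'[OF N] by auto
    then show "p ^ multiplicity p N = p" by simp
  qed
  finally show ?thesis by simp
qed

lemma totient_prod_primes:
  assumes "finite S" "\<forall>p\<in>S. prime p"
  shows "totient (\<Prod>S) = (\<Prod>p\<in>S. p - 1)"
proof -
  have "totient (prod (\<lambda>p. p) S) = (\<Prod>p\<in>S. totient p)"
    using assms by (intro totient_prod_coprime) (auto simp: pairwise_def intro: primes_coprime)
  also have "\<dots> = (\<Prod>p\<in>S. p - 1)" using assms by (intro prod.cong) (auto simp: totient_prime)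
  finally show ?thesis .
qed

lemma prod_primes_dvd:
  fixes N :: nat assumes "finite S" "\<forall>p\<in>S. prime p \<and> p dvd N"
  shows "\<Prod>S dvd N"
  using assms by (induction S rule: finite_induct)
    (auto intro!: divides_mult prod_coprime_right primes_coprime)

text \<open>Every prime in \<open>S\<close> contributes a factor \<open>p - 1\<close>, hence a
  factor \<open>k\<close>, to \<open>totient N\<close>. This is applied with \<open>k = 2\<close> to
  all prime factors, and with \<open>k = q\<close> to those modulo which the order of
  \<open>g\<close> is a multiple of \<open>q\<close>.\<close>

lemma lehmer_power_dvd:
  assumes N: "lehmer N" and "finite S" "\<forall>p\<in>S. prime p \<and> p dvd N \<and> k dvd p - 1"
  shows "k ^ card S dvd N - 1"
proof -
  have "k ^ card S = (\<Prod>p\<in>S. k)" by simp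
  also have "\<dots> dvd (\<Prod>p\<in>S. p - 1)" using assms by (intro prod_dvd_prod) auto
  also have "\<dots> = totient (\<Prod>S)" using assms by (subst totient_prod_primes) auto
  also have "\<dots> dvd totient N" using assms by (intro totient_dvd prod_primes_dvd) auto
  also have "\<dots> dvd N - 1" using N by (simp add: lehmer_def)
  finally show ?thesis .
qed

lemma lehmer_two_power_dvd:
  assumes "lehmer N" shows "2 ^ card (prime_factors N) dvd N - 1"
proof (rule lehmer_power_dvd[OF assms])
  show "\<forall>p\<in>prime_factors N. prime p \<and> p dvd N \<and> 2 dvd p - 1"
    using lehmer_odd[OF assms] by (auto simp: in_prime_factors_iff) (metis dvd_trans even_diff_nat odd_one prime_gt_0_nat)
qed simp

text \<open>For the cofactor \<open>B\<close> of \<open>A\<close>, integrality of \<open>m = (N - 1) / \<phi>(N) \<ge> 2\<close>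
  forces \<open>m \<phi>(A) \<ge> A + 1\<close>, hence \<open>\<phi>(B) / B < 1 - 1 / (A + 1)\<close>.\<close>

lemma lehmer_cofactor_sum:
  assumes N: "lehmer N" and S: "S \<subset> prime_factors N"
  shows "(\<Sum>p\<in>prime_factors N - S. 1 / real p) > 1 / (real (\<Prod>S) + 1)"
proof -
  define T where "T = prime_factors N - S"
  define A where "A = \<Prod>S"
  define B where "B = \<Prod>T"
  have fin: "finite S" "finite T" using S finite_subset by (auto simp: T_def)
  have pr: "\<forall>p\<in>S. prime p" "\<forall>p\<in>T. prime p" using S by (auto simp: T_def in_prime_factors_iff)
  have "T \<noteq> {}" using S by (auto simp: T_def)
  then obtain q where q: "q \<in> T" by blast
  have A0: "A > 0" using pr fin by (auto simp: A_def prime_gt_0_nat intro!: prod_pos)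
  have B0: "B > 0" using pr fin by (auto simp: B_def prime_gt_0_nat intro!: prod_pos)
  have "q dvd B" using q fin by (auto simp: B_def intro: dvd_prodI)
  then have "q \<le> B" using B0 by (rule dvd_imp_le)
  then have B1: "B > 1" using pr q prime_gt_1_nat[of q] by auto
  have AB: "A * B = N"
  proof -
    have "A * B = prod (\<lambda>p. p) (S \<union> T)" unfolding A_def B_def T_def
      using fin S by (subst prod.union_disjoint) auto
    also have "S \<union> T = prime_factors N" using S by (auto simp: T_def)
    finally show ?thesis using squarefree_prod_prime_factors[OF lehmer_squarefree[OF N]] by simp
  qed
  have cop: "coprime A B" unfolding A_def B_def
  proof (intro prod_coprime_left prod_coprime_right)
    fix p q assume "p \<in> S" "q \<in> T"
    then have "p \<noteq> q" "prime p" "prime q" using pr by (auto simp: T_def)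
    then show "coprime p q" by (intro primes_coprime)
  qed
  obtain m where m: "N - 1 = totient N * m" using N by (auto simp: lehmer_def)
  have "N > 1" "\<not> prime N" using N by (auto simp: lehmer_def)
  have "m \<noteq> 0" using m \<open>N > 1\<close> by (intro notI) auto
  moreover have "m \<noteq> 1" using m totient_imp_prime[of N] \<open>N > 1\<close> \<open>\<not> prime N\<close> by (intro notI) auto
  ultimately have m2: "m \<ge> 2" by simp
  have tot: "m * totient A * totient B = A * B - 1"
    using m totient_mult_coprime[OF cop] AB by (simp add: ac_simps)
  have "totient B \<le> B - 1" using totient_less[OF B1] by simp
  \<comment> \<open>Otherwise \<open>A * B - 1 \<le> A * (B - 1)\<close> forces
    \<open>A = 1\<close>, and then \<open>m * totient A = m \<ge> 2\<close>.\<close>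
  have key: "A + 1 \<le> m * totient A"
  proof (rule ccontr)
    assume "\<not> ?thesis"
    then have "m * totient A \<le> A" by simp
    then have "A * B - 1 \<le> A * (B - 1)"
      unfolding tot[symmetric] using \<open>totient B \<le> B - 1\<close> by (intro mult_le_mono)
    moreover obtain b where "B = Suc b" using B0 by (cases B) auto
    ultimately have "A \<le> 1" by simp
    then have "A = 1" using A0 by simp
    then show False using \<open>\<not> A + 1 \<le> m * totient A\<close> m2 by simp
  qed
  have "(A + 1) * totient B \<le> A * B - 1" using key tot by (metis mult_le_mono1)
  then have "(A + 1) * totient B < A * B" using A0 B0 by (metis One_nat_def Suc_pred' le_imp_less_Suc nat_0_less_mult_iff)
  then have "(real A + 1) * real (totient B) < real A * real B"
    by (metis of_nat_Suc of_nat_less_iff of_nat_mult Suc_eq_plus1 add.commute)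
  moreover have "real (totient B) = real B * (\<Prod>p\<in>T. 1 - 1 / real p)"
  proof -
    have "real (totient B) = (\<Prod>p\<in>T. real (p - 1))"
      unfolding B_def using fin pr by (subst totient_prod_primes) auto
    also have "\<dots> = (\<Prod>p\<in>T. real p * (1 - 1 / real p))"
    proof (intro prod.cong refl)
      fix p assume "p \<in> T"
      then have "p \<ge> 1" using pr prime_ge_1_nat by blast
      then show "real (p - 1) = real p * (1 - 1 / real p)" by (simp add: field_simps of_nat_diff)
    qed
    finally show ?thesis by (simp add: prod.distrib B_def)
  qed
  ultimately have "real B * ((real A + 1) * (\<Prod>p\<in>T. 1 - 1 / real p)) < real B * real A"
    by (simp only: mult_ac)
  then have "(real A + 1) * (\<Prod>p\<in>T. 1 - 1 / real p) < real A"
    using B0 by (simp only: mult_less_cancel_left_pos of_nat_0_less_iff)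
  moreover have "(\<Prod>p\<in>T. 1 - 1 / real p) \<ge> 1 - (\<Sum>p\<in>T. 1 / real p)"
  proof (rule Weierstrass_prod_ineq)
    fix p assume "p \<in> T"
    then have "real p \<ge> 1" using pr prime_ge_1_nat by force
    then show "1 / real p \<in> {0..1}" by simp
  qed
  then have "(real A + 1) * (1 - (\<Sum>p\<in>T. 1 / real p)) \<le> (real A + 1) * (\<Prod>p\<in>T. 1 - 1 / real p)"
    by (intro mult_left_mono) auto
  ultimately have "(real A + 1) * (1 - (\<Sum>p\<in>T. 1 / real p)) < real A" by linarith
  then show ?thesis unfolding T_def A_def
    by (simp add: field_simps add_pos_nonneg del: of_nat_prod)
qed

section \<open>Size of a Lehmer number in terms of its number of prime factors\<close>

text \<open>The \<open>j\<close>-th smallest element exceeds \<open>2 ^ j * c\<close>, so the sum is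
  dominated by a geometric series. Adjoining the maximum in the induction adds its next
  term.\<close>

lemma sum_inverse_le_of_sparse:
  fixes S :: "nat set" and c :: real
  assumes "finite S" "c > 0"
    and "\<And>j. j \<ge> 1 \<Longrightarrow> card {p\<in>S. real p \<le> 2 ^ j * c} < j"
  shows "(\<Sum>p\<in>S. 1 / real p) \<le> (1 - 1 / 2 ^ card S) / c"
  using assms(1,3)
proof (induction S rule: finite_linorder_max_induct)
  case empty then show ?case by simp
next
  case (insert b S)
  have bS: "b \<notin> S" using insert by auto
  have IH: "(\<Sum>p\<in>S. 1 / real p) \<le> (1 - 1 / 2 ^ card S) / c"
  proof (rule insert.IH)
    fix j :: nat assume "j \<ge> 1"
    have "card {p\<in>S. real p \<le> 2 ^ j * c} \<le> card {p\<in>insert b S. real p \<le> 2 ^ j * c}"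
      using insert by (intro card_mono) auto
    then show "card {p\<in>S. real p \<le> 2 ^ j * c} < j" using insert.prems[OF \<open>j \<ge> 1\<close>] by simp
  qed
  have "2 ^ Suc (card S) * c < real b"
  proof (rule ccontr)
    assume "\<not> ?thesis"
    then have "{p\<in>insert b S. real p \<le> 2 ^ Suc (card S) * c} = insert b S"
      using insert by (force intro: order.trans[of _ "real b"])
    then show False using insert.prems[of "Suc (card S)"] insert bS by simp
  qed
  moreover from this have "real b > 0" using \<open>c > 0\<close> by (smt (verit) zero_less_power mult_pos_pos)
  ultimately have "1 / real b \<le> 1 / (2 ^ Suc (card S) * c)"
    using \<open>c > 0\<close> by (intro divide_left_mono mult_pos_pos) auto
  then have "(\<Sum>p\<in>insert b S. 1 / real p) \<le> 1 / (2 ^ Suc (card S) * c) + (1 - 1 / 2 ^ card S) / c"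
    using IH bS insert by simp
  also have "\<dots> = (1 - 1 / 2 ^ card (insert b S)) / c"
    using bS insert \<open>c > 0\<close> by (simp add: field_simps)
  finally show ?case .
qed

text \<open>If for every \<open>j \<ge> 1\<close> fewer than \<open>j\<close> of the remaining
  primes were at most \<open>2 ^ j * (\<Prod>S + 1)\<close>, their reciprocals would be too sparse
  for the lower bound of \<open>lehmer_cofactor_sum\<close>.\<close>

lemma lehmer_small_cofactor_primes:
  assumes N: "lehmer N" and S: "S \<subset> prime_factors N"
  obtains J where "J \<subseteq> prime_factors N - S" "J \<noteq> {}" "\<forall>p\<in>J. p \<le> 2 ^ card J * (\<Prod>S + 1)"
proof -
  let ?T = "prime_factors N - S" and ?c = "real (\<Prod>S) + 1"
  have "\<exists>j\<ge>1. card {p\<in>?T. real p \<le> 2 ^ j * ?c} \<ge> j"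
  proof (rule ccontr)
    assume "\<not> ?thesis"
    then have *: "card {p\<in>?T. real p \<le> 2 ^ j * ?c} < j" if "j \<ge> 1" for j
      using that by (meson not_le)
    have "?c > 0" by (rule add_nonneg_pos[OF of_nat_0_le_iff zero_less_one])
    then have "(\<Sum>p\<in>?T. 1 / real p) \<le> (1 - 1 / 2 ^ card ?T) / ?c"
      by (intro sum_inverse_le_of_sparse[OF _ _ *] finite_Diff finite_set_mset)
    also have "\<dots> \<le> 1 / ?c" using \<open>?c > 0\<close> by (intro divide_right_mono) simp_all
    finally show False using lehmer_cofactor_sum[OF N S] by simp
  qed
  then obtain j where j: "j \<ge> 1" "card {p\<in>?T. real p \<le> 2 ^ j * ?c} \<ge> j" by blast
  define J where "J = {p\<in>?T. real p \<le> 2 ^ j * ?c}"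
  have jJ: "j \<le> card J" using j by (simp add: J_def)
  have "\<forall>p\<in>J. p \<le> 2 ^ card J * (\<Prod>S + 1)"
  proof
    fix p assume "p \<in> J"
    then have "real p \<le> 2 ^ j * ?c" by (simp add: J_def)
    also have "\<dots> = real (2 ^ j * (\<Prod>S + 1))" by (simp add: algebra_simps)
    finally have "p \<le> 2 ^ j * (\<Prod>S + 1)" by linarith
    also have "\<dots> \<le> 2 ^ card J * (\<Prod>S + 1)" using jJ by (intro mult_le_mono power_increasing) auto
    finally show "p \<le> 2 ^ card J * (\<Prod>S + 1)" .
  qed
  moreover have "J \<subseteq> ?T" by (auto simp: J_def)
  moreover have "J \<noteq> {}" using jJ j by auto
  ultimately show ?thesis using that by blast
qed

text \<open>Equality at \<open>j = 1\<close> and \<open>j = 2\<close> is what calls for the constant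
  4 in \<open>lehmer_tail_bound\<close>.\<close>

lemma square_plus_le_two_power: "j * j + j + 2 \<le> (2::nat) ^ (j + 1)" if "j \<ge> 1"
  using that
proof (induction j rule: dec_induct)
  case (step j)
  have "Suc j \<le> 2 ^ j" using less_exp[of j] by (simp add: Suc_leI)
  then show ?case using step by (simp add: algebra_simps)
qed simp

text \<open>The quantity \<open>4A\<close> at most squares with every prime adjoined to \<open>A\<close>,
  on average over a suitable set \<open>J\<close> of primes.\<close>

lemma lehmer_tail_bound:
  assumes N: "lehmer N" and "S \<subseteq> prime_factors N"
  shows "4 * N \<le> (4 * \<Prod>S) ^ (2 ^ card (prime_factors N - S))"
  using assms(2)
proof (induction "card (prime_factors N - S)" arbitrary: S rule: less_induct)
  case less
  show ?case
  proof (cases "S = prime_factors N")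
    case True
    then show ?thesis using squarefree_prod_prime_factors[OF lehmer_squarefree[OF N]] by simp
  next
    case False
    then have "S \<subset> prime_factors N" using less.prems by blast
    then obtain J where J: "J \<subseteq> prime_factors N - S" "J \<noteq> {}"
        "\<forall>p\<in>J. p \<le> 2 ^ card J * (\<Prod>S + 1)"
      using lehmer_small_cofactor_primes[OF N] by metis
    define A where "A = \<Prod>S"
    define j where "j = card J"
    have finJ: "finite J" using J finite_subset by blast
    have finS: "finite S" using less.prems finite_subset by blast
    have A1: "A \<ge> 1" unfolding A_def
      using less.prems by (intro prod_ge_1) (blast intro: prime_ge_1_nat in_prime_factors_imp_prime)
    have j1: "j \<ge> 1" using J finJ by (simp add: j_def Suc_leI card_gt_0_iff)
    have card: "card (prime_factors N - S) = j + card (prime_factors N - (S \<union> J))"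
    proof -
      have "prime_factors N - S = J \<union> (prime_factors N - (S \<union> J))" using J by auto
      moreover have "card (J \<union> (prime_factors N - (S \<union> J))) = card J + card (prime_factors N - (S \<union> J))"
        using finJ by (intro card_Un_disjoint) auto
      ultimately show ?thesis by (simp add: j_def)
    qed
    have "\<Prod>J \<le> (\<Prod>p\<in>J. 2 ^ j * (A + 1))" using J by (intro prod_mono) (auto simp: j_def A_def)
    also have "\<dots> = (2 ^ j * (A + 1)) ^ j" by (simp add: j_def)
    also have "\<dots> \<le> (2 ^ j * (2 * A)) ^ j" using A1 by (intro power_mono mult_le_mono) auto
    also have "\<dots> = 2 ^ (j * j + j) * A ^ j" by (simp add: power_mult_distrib power_add power_mult)
    finally have PJ: "\<Prod>J \<le> 2 ^ (j * j + j) * A ^ j" .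
    have "4 * \<Prod>(S \<union> J) = 4 * A * \<Prod>J"
      unfolding A_def using finJ finS J by (subst prod.union_disjoint) auto
    also have "\<dots> \<le> 4 * A * (2 ^ (j * j + j) * A ^ j)" using PJ by simp
    also have "\<dots> = 2 ^ (j * j + j + 2) * A ^ Suc j" by (simp add: power_add)
    \<comment> \<open>The two exponents are compared separately, by
      \<open>j * j + j + 2 \<le> 2 ^ (j + 1)\<close> and \<open>Suc j \<le> 2 ^ j\<close>.\<close>
    also have "\<dots> \<le> 2 ^ (2 ^ (j + 1)) * A ^ (2 ^ j)"
      using square_plus_le_two_power[OF j1] A1 less_exp[of j]
      by (intro mult_le_mono power_increasing) (auto simp: Suc_leI)
    also have "\<dots> = (4 * A) ^ (2 ^ j)" by (simp add: power_mult_distrib power_mult)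
    finally have step: "4 * \<Prod>(S \<union> J) \<le> (4 * A) ^ (2 ^ j)" .
    have "4 * N \<le> (4 * \<Prod>(S \<union> J)) ^ (2 ^ card (prime_factors N - (S \<union> J)))"
      using less.hyps[of "S \<union> J"] card j1 less.prems J by auto
    also have "\<dots> \<le> ((4 * A) ^ (2 ^ j)) ^ (2 ^ card (prime_factors N - (S \<union> J)))"
      using step by (intro power_mono) auto
    also have "\<dots> = (4 * A) ^ (2 ^ card (prime_factors N - S))"
      by (simp add: card power_add power_mult_distrib flip: power_mult)
    finally show ?thesis by (simp add: A_def)
  qed
qed

subsection \<open>Repunits\<close>

lemma repunit_eq_sum:
  assumes "g \<ge> 2" shows "repunit g n = (\<Sum>i<n. g ^ i)"
proof -
  obtain k where k: "g = Suc k" "k \<ge> 1" using assms by (cases g) auto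
  have "k * (\<Sum>i<n. g ^ i) = g ^ n - 1"
  proof -
    have "k * (\<Sum>i<n. g ^ i) + 1 = g ^ n" by (induction n) (auto simp: k algebra_simps)
    then show ?thesis by simp
  qed
  then show ?thesis using k unfolding repunit_def by (metis diff_Suc_1 div_mult_self_is_m less_eq_Suc_le mult.commute One_nat_def)
qed

lemma repunit_0 [simp]: "repunit g 0 = 0"
  by (simp add: repunit_def)

lemma repunit_1: "g \<ge> 2 \<Longrightarrow> repunit g (Suc 0) = 1"
  by (simp add: repunit_eq_sum)

lemma repunit_Suc: "g \<ge> 2 \<Longrightarrow> repunit g (Suc n) = repunit g n + g ^ n"
  by (simp add: repunit_eq_sum)

lemma repunit_Suc': "g \<ge> 2 \<Longrightarrow> repunit g (Suc n) = 1 + g * repunit g n"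
  by (simp add: repunit_eq_sum sum.lessThan_Suc_shift sum_distrib_left del: sum.lessThan_Suc)

lemma repunit_minus_1:
  assumes "g \<ge> 2" "n \<ge> 1" shows "repunit g n - 1 = g * repunit g (n - 1)"
  using assms repunit_Suc'[of g "n - 1"] by simp

lemma repunit_mult_base_minus_1: "g \<ge> 2 \<Longrightarrow> (g - 1) * repunit g n + 1 = g ^ n"
proof (induction n)
  case (Suc n)
  then obtain k where "g = Suc k" by (cases g) auto
  with Suc show ?case by (simp add: repunit_Suc algebra_simps)
qed simp

lemma repunit_less_power: "g \<ge> 2 \<Longrightarrow> repunit g n < g ^ n"
  using repunit_mult_base_minus_1[of g n] by (cases "g - 1") auto

lemma power_le_repunit: "g \<ge> 2 \<Longrightarrow> n \<ge> 1 \<Longrightarrow> g ^ (n - 1) \<le> repunit g n"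
  using repunit_Suc[of g "n - 1"] by simp

lemma repunit_pos: "g \<ge> 2 \<Longrightarrow> n \<ge> 1 \<Longrightarrow> repunit g n > 0"
  using repunit_Suc'[of g "n - 1"] by simp

lemma repunit_mult:
  assumes "g \<ge> 2" "a \<ge> 1" shows "repunit g (a * b) = repunit g a * repunit (g ^ a) b"
proof -
  have ga: "g ^ a \<ge> 2" using assms self_le_power[of g a] by simp
  have "(g - 1) * repunit g (a * b) + 1 = (g ^ a) ^ b"
    using repunit_mult_base_minus_1[OF assms(1)] by (simp add: power_mult)
  also have "\<dots> = (g ^ a - 1) * repunit (g ^ a) b + 1"
    using repunit_mult_base_minus_1[OF ga] by simp
  also have "g ^ a - 1 = (g - 1) * repunit g a"
    using repunit_mult_base_minus_1[OF assms(1), of a] by simp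
  finally have "(g - 1) * repunit g (a * b) = (g - 1) * (repunit g a * repunit (g ^ a) b)"
    by (simp add: mult.assoc)
  then show ?thesis using assms by simp
qed

lemma repunit_dvd:
  assumes "g \<ge> 2" "a dvd b" shows "repunit g a dvd repunit g b"
proof (cases "a = 0")
  case True then show ?thesis using assms by simp
next
  case False
  with assms show ?thesis by (auto simp: repunit_mult elim!: dvdE)
qed

lemma repunit_less_repunit:
  assumes "g \<ge> 2" "a < b" shows "repunit g a < repunit g b"
  unfolding repunit_eq_sum[OF assms(1)]
  using assms by (intro sum_strict_mono2[of _ _ a]) auto

lemma cong_repunit:
  assumes "g \<ge> 2" "p dvd g - 1" shows "[repunit g n = n] (mod p)"
proof -
  have g: "[g = 1] (mod p)" using assms cong_altdef_nat[of 1 g p] by (simp add: cong_sym_eq)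
  have "[(\<Sum>i<n. g ^ i) = (\<Sum>i<n. 1 ^ i)] (mod p)"
    using g by (intro cong_sum cong_pow)
  then show ?thesis using assms by (simp add: repunit_eq_sum)
qed

lemma odd_repunit_odd: "g \<ge> 2 \<Longrightarrow> odd g \<Longrightarrow> odd (repunit g n) \<longleftrightarrow> odd n"
  by (induction n) (auto simp: repunit_Suc)

text \<open>Multiplying by \<open>g - 1\<close>, which is invertible modulo \<open>p\<close>, turns
  the repunit into \<open>g ^ n - 1\<close>.\<close>

lemma prime_dvd_repunit_iff:
  assumes "g \<ge> 2" "prime p" "\<not> p dvd g - 1"
  shows "p dvd repunit g n \<longleftrightarrow> ord p g dvd n"
proof -
  have "p dvd repunit g n \<longleftrightarrow> p dvd (g - 1) * repunit g n"
    using assms by (simp add: prime_dvd_mult_iff)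
  also have "(g - 1) * repunit g n = g ^ n - 1"
    using repunit_mult_base_minus_1[OF assms(1), of n] by simp
  also have "p dvd g ^ n - 1 \<longleftrightarrow> [g ^ n = 1] (mod p)"
    using assms by (simp add: cong_altdef_nat)
  also have "\<dots> \<longleftrightarrow> ord p g dvd n" by (rule ord_divides)
  finally show ?thesis .
qed

lemma lehmer_repunit_ge_2:
  assumes "g \<ge> 2" "lehmer (repunit g n)" shows "n \<ge> 2"
proof (rule ccontr)
  assume "\<not> ?thesis"
  then have "n = 0 \<or> n = Suc 0" by auto
  then show False using assms by (auto simp: repunit_1 lehmer_def)
qed

text \<open>If \<open>p\<close> divided both, then all prime factors of the factor \<open>repunit g p\<close> would
  equal \<open>p\<close>, as any other one would be \<open>1\<close> modulo \<open>p\<close>; this factor is thus \<open>p\<close>, which is too small.\<close>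

lemma lehmer_repunit_coprime:
  assumes g: "g \<ge> 2" and N: "lehmer (repunit g n)" and p: "prime p" "p dvd n"
  shows "\<not> p dvd repunit g n"
proof
  assume pN: "p dvd repunit g n"
  let ?M = "repunit g p"
  have MN: "?M dvd repunit g n" using g p by (intro repunit_dvd)
  have p2: "p \<ge> 2" using p by (simp add: prime_ge_2_nat)
  have "q = p" if q: "prime q" "q dvd ?M" for q
  proof (rule ccontr)
    assume "q \<noteq> p"
    have "p dvd q - 1"
    proof (cases "q dvd g - 1")
      case True
      \<comment> \<open>Modulo a divisor of \<open>g - 1\<close>, the number \<open>?M\<close> is
        congruent to \<open>p\<close>.\<close>
      have "q dvd p" using cong_dvd_iff[OF cong_repunit[OF g True, of p]] q by simp
      then show ?thesis using \<open>q \<noteq> p\<close> p q by (simp add: primes_dvd_imp_eq)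
    next
      case False
      then have "ord q g dvd p" using q g by (simp add: prime_dvd_repunit_iff)
      moreover have "ord q g \<noteq> 1"
      proof
        assume "ord q g = 1"
        then have "[g = 1] (mod q)" by (simp add: ord_eq_Suc_0_iff)
        then show False using False g by (simp add: cong_altdef_nat)
      qed
      ultimately have "ord q g = p" using p by (auto simp: prime_nat_iff)
      moreover have "ord q g dvd totient q" 
        using \<open>ord q g dvd p\<close> p order_divides_totient[of q g] ord_eq_0[of q g] by force
      ultimately show ?thesis using q by (simp add: totient_prime)
    qed
    moreover have "\<not> p dvd q - 1"
      using N q p pN MN dvd_trans by (intro lehmer_not_dvd_prime_minus_1) blast+
    ultimately show False by simp
  qed
  then have "prime_factors ?M \<subseteq> {p}" by (auto simp: in_prime_factors_iff)
  moreover have "squarefree ?M" using MN lehmer_squarefree[OF N] squarefree_mono by blast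
  ultimately have "?M \<le> p"
    using squarefree_prod_prime_factors[of ?M] p2 by (auto simp: subset_singleton_iff)
  \<comment> \<open>The contradiction is one of size: \<open>?M\<close> is
    \<open>g ^ (p - 1)\<close> plus a positive number, hence exceeds \<open>p\<close>.\<close>
  moreover have "p < g ^ (p - 1) + 1"
  proof -
    have "p - 1 < 2 ^ (p - 1)" by (rule less_exp)
    also have "\<dots> \<le> g ^ (p - 1)" using g by (intro power_mono) auto
    finally show ?thesis by simp
  qed
  moreover have "?M = repunit g (p - 1) + g ^ (p - 1)"
    using repunit_Suc[OF g, of "p - 1"] p2 by simp
  moreover have "repunit g (p - 1) > 0" using g p2 by (intro repunit_pos) auto
  ultimately show False by linarith
qed

text \<open>Modulo such a prime the repunit is congruent to \<open>n\<close>, so \<open>p\<close>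
  would divide \<open>n\<close> as well, which \<open>lehmer_repunit_coprime\<close>
  excludes.\<close>

lemma lehmer_repunit_not_dvd_base_minus_1:
  assumes g: "g \<ge> 2" and N: "lehmer (repunit g n)" and p: "prime p" "p dvd repunit g n"
  shows "\<not> p dvd g - 1"
proof
  assume "p dvd g - 1"
  then have "p dvd n" using cong_dvd_iff[OF cong_repunit[OF g, of p n]] p by simp
  then show False using lehmer_repunit_coprime[OF g N p(1)] p by simp
qed

text \<open>For \<open>h\<close> congruent to 1 modulo 4, the factors \<open>h ^ k + 1\<close> split off by halving the
  exponent contribute a single factor 2 each.\<close>

lemma two_power_dvd_repunit:
  assumes h: "h \<ge> 2" "h mod 4 = 1" and "2 ^ t dvd repunit h m"
  shows "2 ^ t dvd m"
  using assms(3)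
proof (induction m arbitrary: t rule: less_induct)
  case (less m)
  have oddh: "odd h" using h by presburger
  show ?case
  proof (cases "t = 0 \<or> m = 0")
    case True then show ?thesis by auto
  next
    case False
    then obtain s where t: "t = Suc s" by (cases t) auto
    have "even (repunit h m)" using less.prems t by (auto elim: dvd_mult_left)
    then have "even m" using odd_repunit_odd[OF h(1) oddh] by auto
    then obtain k where k: "m = k * 2" "k \<ge> 1" using False by (auto elim!: evenE)
    have "repunit h m = repunit h k * (h ^ k + 1)"
    proof -
      have "h ^ k \<ge> 2" using h k self_le_power[of h k] by simp
      then have "repunit (h ^ k) (Suc (Suc 0)) = h ^ k + 1" by (simp add: repunit_Suc)
      then show ?thesis unfolding k(1) using repunit_mult[OF h(1) k(2), of 2] by (simp add: numeral_2_eq_2)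
    qed
    moreover have "(h ^ k) mod 4 = 1" using h power_mod[of h 4 k] by simp
    then obtain r where "h ^ k + 1 = 2 * r" "odd r"
    proof -
      assume *: "\<And>r. h ^ k + 1 = 2 * r \<Longrightarrow> odd r \<Longrightarrow> thesis"
      show thesis using \<open>(h ^ k) mod 4 = 1\<close> by (intro *[of "(h ^ k + 1) div 2"]) presburger+
    qed
    ultimately have "repunit h m = 2 * (repunit h k * r)" by (simp only: mult_ac)
    then have "2 * 2 ^ s dvd 2 * (repunit h k * r)"
      using less.prems t by (simp only: power_Suc)
    then have "2 ^ s dvd repunit h k * r" by (simp only: dvd_times_left_cancel_iff)
    moreover have "coprime (2 ^ s) r" using \<open>odd r\<close> by (simp add: coprime_commute)
    ultimately have "2 ^ s dvd repunit h k" by (simp add: coprime_dvd_mult_left_iff)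
    then have "2 ^ s dvd k" using less.IH[of k s] k by simp
    then show ?thesis by (simp add: t k(1))
  qed
qed

section \<open>The power of 2 in \<open>N - 1\<close> for even and for odd bases\<close>

text \<open>In \<open>N - 1 = g * repunit g (n - 1)\<close> the second factor is odd, so
  \<open>2 ^ K\<close> divides \<open>g\<close>, where \<open>K\<close> is the number of prime
  factors. The case \<open>S = {}\<close> of \<open>lehmer_tail_bound\<close> then bounds
  \<open>N\<close>.\<close>

lemma even_lehmer_repunit_bound:
  assumes g: "g \<ge> 2" "even g" and N: "lehmer (repunit g n)"
  shows "repunit g n \<le> 4 ^ 2 ^ multiplicity 2 g"
proof -
  let ?N = "repunit g n"
  have n: "n \<ge> 2" using lehmer_repunit_ge_2[OF g(1) N] .
  then obtain k where "n - 1 = Suc k" by (cases "n - 1") auto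
  then have "odd (repunit g (n - 1))" using g by (simp add: repunit_Suc')
  then have cop: "coprime (2 ^ card (prime_factors ?N)) (repunit g (n - 1))"
    by (simp add: coprime_commute)
  have "2 ^ card (prime_factors ?N) dvd g * repunit g (n - 1)"
    using lehmer_two_power_dvd[OF N] repunit_minus_1[OF g(1), of n] n by simp
  then have "2 ^ card (prime_factors ?N) dvd g" using cop by (simp add: coprime_dvd_mult_left_iff)
  then have "card (prime_factors ?N) \<le> multiplicity 2 g"
    using g by (intro multiplicity_geI) auto
  then have "(4::nat) ^ 2 ^ card (prime_factors ?N) \<le> 4 ^ 2 ^ multiplicity 2 g"
    by (intro power_increasing) auto
  moreover have "4 * ?N \<le> 4 ^ 2 ^ card (prime_factors ?N)"
    using lehmer_tail_bound[OF N, of "{}"] by simp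
  ultimately show ?thesis by linarith
qed

text \<open>Here \<open>n\<close> is odd, and \<open>n - 1 = 2 * m\<close> gives
  \<open>N - 1 = g * (g + 1) * repunit (g ^ 2) m\<close>. Since \<open>g ^ 2 mod 4 = 1\<close>, the
  last factor is no more divisible by 2 than \<open>m\<close>.\<close>

lemma odd_lehmer_repunit_card:
  assumes g: "g \<ge> 2" "odd g" and N: "lehmer (repunit g n)"
  shows "2 ^ card (prime_factors (repunit g n)) \<le> 2 ^ multiplicity 2 (g + 1) * (n - 1)"
proof -
  let ?l = "multiplicity 2 (g + 1)" and ?K = "card (prime_factors (repunit g n))"
  have n: "n \<ge> 2" using lehmer_repunit_ge_2[OF g(1) N] .
  have "odd n" using odd_repunit_odd[OF g] lehmer_odd[OF N] by simp
  then obtain m where m: "n = 2 * m + 1" by (auto elim: oddE)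
  have m1: "m \<ge> 1" using m n by simp
  have gg: "g ^ 2 \<ge> 2" using g self_le_power[of g 2] by simp
  have g4: "g ^ 2 mod 4 = 1"
  proof -
    obtain k where "g = 2 * k + 1" using g by (auto elim: oddE)
    then have "g ^ 2 = 4 * (k * k + k) + 1" by (simp add: power2_eq_square algebra_simps)
    then show ?thesis by (simp only: mod_mult_self4) simp
  qed
  have "2 ^ ?K dvd g * repunit g (n - 1)"
    using lehmer_two_power_dvd[OF N] repunit_minus_1[OF g(1), of n] n by simp
  moreover have "coprime (2 ^ ?K) g" using g by (simp add: coprime_commute)
  ultimately have "2 ^ ?K dvd repunit g (n - 1)" by (simp add: coprime_dvd_mult_right_iff)
  also have "n - 1 = 2 * m" using m by simp
  also have "repunit g (2 * m) = (g + 1) * repunit (g ^ 2) m"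
    using repunit_mult[OF g(1), of 2 m] g by (simp add: repunit_Suc numeral_2_eq_2)
  finally have dvd: "2 ^ ?K dvd (g + 1) * repunit (g ^ 2) m" .
  obtain q where q: "g + 1 = 2 ^ ?l * q" "\<not> 2 dvd q"
    using multiplicity_decompose'[of "g + 1" 2] by auto
  show ?thesis
  proof (cases "?K \<le> ?l")
    case True
    then have "(2::nat) ^ ?K \<le> 2 ^ ?l * 1" by simp
    also have "\<dots> \<le> 2 ^ ?l * (n - 1)" using n by (intro mult_le_mono) auto
    finally show ?thesis .
  next
    case False
    then have split: "(2::nat) ^ ?K = 2 ^ ?l * 2 ^ (?K - ?l)" by (simp flip: power_add)
    have "2 ^ ?l * 2 ^ (?K - ?l) dvd 2 ^ ?l * (q * repunit (g ^ 2) m)"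
      using dvd unfolding split[symmetric] by (metis q(1) mult.assoc)
    then have "2 ^ (?K - ?l) dvd q * repunit (g ^ 2) m" by simp
    moreover have "coprime (2 ^ (?K - ?l)) q" using q by (simp add: coprime_commute)
    ultimately have "2 ^ (?K - ?l) dvd repunit (g ^ 2) m" by (simp add: coprime_dvd_mult_right_iff)
    then have "2 ^ (?K - ?l) dvd m" by (rule two_power_dvd_repunit[OF gg g4])
    then have "2 ^ (?K - ?l) \<le> m" using m1 by (intro dvd_imp_le) auto
    then have "2 ^ ?l * 2 ^ (?K - ?l) \<le> 2 ^ ?l * (n - 1)" using m by (intro mult_le_mono) auto
    then show ?thesis using split by simp
  qed
qed

subsection \<open>Bounding the exponent for odd bases\<close>

text \<open>This turns an inequality of the form \<open>2 ^ j \<le> C * j ^ 2\<close> into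
  \<open>j \<le> 4 * C\<close>. The factor 4 is attained at \<open>j = 4\<close>.\<close>

lemma cube_le_two_power: "j ^ 3 \<le> 4 * (2::nat) ^ j"
proof (cases "j \<ge> 4")
  case True
  then show ?thesis
  proof (induction j rule: dec_induct)
    case (step j)
    have "4 * j \<le> j * j" using step(1) by simp
    then have "3 * (j * j) + 3 * j + 1 \<le> 4 * (j * j)" using step(1) by linarith
    also have "\<dots> \<le> j * (j * j)" using step(1) by (intro mult_le_mono1)
    finally have "(Suc j) ^ 3 \<le> 2 * j ^ 3" by (simp add: power3_eq_cube algebra_simps)
    then show ?case using step.IH by simp
  qed simp
next
  case False
  then have "j = 0 \<or> j = 1 \<or> j = 2 \<or> j = 3" by auto
  then show ?thesis by auto
qed

text \<open>Bounds \<open>u * d\<close> for the divisor \<open>d\<close> found in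
  \<open>small_order\<close>, and thereby the next divisor \<open>lcm u d\<close> of
  \<open>n\<close>.\<close>

definition order_bound :: "nat \<Rightarrow> nat \<Rightarrow> nat" where
  "order_bound c u = 2 ^ (23 * c * c * u)"

lemma le_order_bound:
  assumes "c > 0" shows "u \<le> order_bound c u"
proof -
  have "u \<le> 23 * c * c * u" using assms by simp
  also have "\<dots> \<le> order_bound c u" unfolding order_bound_def by (rule less_imp_le[OF less_exp])
  finally show ?thesis .
qed

lemma order_bound_mono: "u \<le> v \<Longrightarrow> order_bound c u \<le> order_bound c v"
  by (simp add: order_bound_def)

text \<open>As \<open>4 ^ c\<close> bounds \<open>g\<close> and \<open>order_bound c 1\<close>
  bounds some prime factor \<open>q\<close> of \<open>n\<close>, the number of iterations is at
  least \<open>g ^ q + 1\<close>.\<close>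

definition exponent_bound :: "nat \<Rightarrow> nat" where
  "exponent_bound c = (order_bound c ^^ ((4 ^ c) ^ order_bound c 1 + 1)) 1"

text \<open>Only an upper bound \<open>c\<close> for the power of 2 in \<open>g + 1\<close> is
  fixed, so that \<open>c = 2 ^ l\<close> can be taken with \<open>l\<close> depending on
  \<open>L\<close> alone.\<close>

locale odd_lehmer_repunit =
  fixes g n c :: nat
  assumes g: "g \<ge> 2" "odd g"
    and lehmer: "lehmer (repunit g n)"
    and c: "2 ^ multiplicity 2 (g + 1) \<le> c"
begin

abbreviation "N \<equiv> repunit g n"

lemma n_ge_2: "n \<ge> 2"
  using lehmer_repunit_ge_2[OF g(1) lehmer] .

lemma odd_n: "odd n"
  using odd_repunit_odd[OF g] lehmer_odd[OF lehmer] by simp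

lemma c_pos: "c > 0"
  using c by (metis gr0I le_zero_eq power_not_zero zero_neq_numeral)

lemma N_pos: "N > 0"
  using lehmer by (simp add: lehmer_def)

lemma two_power_card_le: "2 ^ card (prime_factors N) \<le> c * (n - 1)"
proof -
  have "2 ^ card (prime_factors N) \<le> 2 ^ multiplicity 2 (g + 1) * (n - 1)"
    using odd_lehmer_repunit_card[OF g lehmer] .
  also have "\<dots> \<le> c * (n - 1)" using c by (rule mult_le_mono1)
  finally show ?thesis .
qed

text \<open>The bound \<open>2 ^ \<omega>(N) \<le> c (n - 1)\<close> is so close to the minimum allowed by
  \<open>lehmer_tail_bound\<close> that products of prime factors of \<open>N\<close> grow doubly exponentially.\<close>

lemma sparse_prime_factors:
  assumes S: "S \<subseteq> prime_factors N"
  shows "g ^ 2 ^ card S \<le> (4 * \<Prod>S) ^ c"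
proof -
  let ?A = "\<Prod>S" and ?K = "card (prime_factors N)"
  have finS: "finite S" using S finite_subset by blast
  have A1: "?A \<ge> 1" using S by (intro prod_ge_1) (blast intro: prime_ge_1_nat in_prime_factors_imp_prime)
  have K: "card (prime_factors N - S) + card S = ?K"
    using S finS by (simp add: card_Diff_subset card_mono)
  have "g ^ (n - 1) \<le> 4 * N" using power_le_repunit[OF g(1), of n] n_ge_2 by simp
  also have "\<dots> \<le> (4 * ?A) ^ 2 ^ card (prime_factors N - S)" by (rule lehmer_tail_bound[OF lehmer S])
  \<comment> \<open>Raising to the power \<open>2 ^ card S\<close> makes the exponent on the right
    \<open>2 ^ ?K\<close>, which is at most \<open>c * (n - 1)\<close>. The root of order
    \<open>n - 1\<close> is taken at the end.\<close>
  finally have "(g ^ (n - 1)) ^ 2 ^ card S \<le> ((4 * ?A) ^ 2 ^ card (prime_factors N - S)) ^ 2 ^ card S"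
    by (intro power_mono) auto
  also have "\<dots> = (4 * ?A) ^ 2 ^ ?K" by (simp only: K power_mult[symmetric] power_add[symmetric])
  also have "\<dots> \<le> (4 * ?A) ^ (c * (n - 1))"
    using A1 two_power_card_le by (intro power_increasing) auto
  finally have "(g ^ 2 ^ card S) ^ (n - 1) \<le> ((4 * ?A) ^ c) ^ (n - 1)"
    by (simp only: power_mult[symmetric] mult.commute)
  then show ?thesis using n_ge_2 by (subst (asm) power_mono_iff) auto
qed

lemma base_le: "g \<le> 4 ^ c"
  using sparse_prime_factors[of "{}"] by simp

text \<open>There is a nonempty set of \<open>j\<close> further primes, each at most
  \<open>2 ^ (j + a)\<close>. As \<open>sparse_prime_factors\<close> makes their product grow doubly
  exponentially in \<open>j\<close>, this bounds \<open>j\<close>.\<close>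

lemma small_prime_factor:
  assumes S: "S \<subset> prime_factors N" and a: "\<Prod>S + 1 \<le> 2 ^ a"
  shows "\<exists>p\<in>prime_factors N - S. p \<le> 2 ^ (4 * c * (3 + a) + a)"
proof -
  obtain J where J: "J \<subseteq> prime_factors N - S" "J \<noteq> {}" "\<forall>p\<in>J. p \<le> 2 ^ card J * (\<Prod>S + 1)"
    using lehmer_small_cofactor_primes[OF lehmer S] by metis
  define j where "j = card J"
  have finJ: "finite J" using J finite_subset by blast
  have j1: "j \<ge> 1" using J finJ by (simp add: j_def Suc_leI card_gt_0_iff)
  have Ja: "p \<le> 2 ^ (j + a)" if "p \<in> J" for p
  proof -
    have "p \<le> 2 ^ j * (\<Prod>S + 1)" using J that by (simp add: j_def)
    also have "\<dots> \<le> 2 ^ j * 2 ^ a" using a by (rule mult_le_mono2)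
    finally show ?thesis by (simp add: power_add)
  qed
  have "\<Prod>J \<le> (\<Prod>p\<in>J. 2 ^ (j + a))" using Ja by (intro prod_mono) auto
  also have "\<dots> = 2 ^ ((j + a) * j)" by (simp add: j_def power_mult)
  finally have PJ: "4 * \<Prod>J \<le> 2 ^ (2 + (j + a) * j)" by simp
  have "(2::nat) ^ 2 ^ j \<le> g ^ 2 ^ j" using g by (intro power_mono) auto
  also have "\<dots> \<le> (4 * \<Prod>J) ^ c" unfolding j_def using J by (intro sparse_prime_factors) auto
  also have "\<dots> \<le> (2 ^ (2 + (j + a) * j)) ^ c" using PJ by (intro power_mono) auto
  also have "\<dots> = 2 ^ (c * (2 + (j + a) * j))" by (simp only: power_mult[symmetric] mult.commute[of c])
  finally have "2 ^ j \<le> c * (2 + (j + a) * j)" by (subst (asm) power_increasing_iff) auto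
  also have "\<dots> \<le> c * ((3 + a) * (j * j))"
  proof (rule mult_le_mono2)
    have "1 \<le> j * j" "j \<le> j * j" using j1 by auto
    then have "a * j \<le> a * (j * j)" by (intro mult_le_mono2)
    then show "2 + (j + a) * j \<le> (3 + a) * (j * j)" 
      unfolding add_mult_distrib using \<open>1 \<le> j * j\<close> by linarith
  qed
  finally have two: "2 ^ j \<le> c * ((3 + a) * (j * j))" .
  \<comment> \<open>The cubic lower bound for \<open>2 ^ j\<close> absorbs the factor
    \<open>j * j\<close> and leaves a bound for \<open>j\<close> linear in \<open>a\<close>.\<close>
  have "j * (j * j) \<le> 4 * 2 ^ j" using cube_le_two_power[of j] by (simp add: power3_eq_cube)
  also have "\<dots> \<le> 4 * (c * ((3 + a) * (j * j)))" using two by (rule mult_le_mono2)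
  also have "\<dots> = 4 * c * (3 + a) * (j * j)" by (simp only: mult.assoc)
  finally have "j * (j * j) \<le> 4 * c * (3 + a) * (j * j)" .
  then have "j \<le> 4 * c * (3 + a)" using j1 by simp
  obtain p where "p \<in> J" using J by blast
  then have "p \<le> 2 ^ (j + a)" by (rule Ja)
  also have "\<dots> \<le> 2 ^ (4 * c * (3 + a) + a)"
    using \<open>j \<le> 4 * c * (3 + a)\<close> by (intro power_increasing) auto
  finally show ?thesis using \<open>p \<in> J\<close> J by blast
qed

lemma ord_dvd:
  assumes "prime p" "p dvd N"
  shows "p dvd repunit g m \<longleftrightarrow> ord p g dvd m" "ord p g dvd n" "ord p g dvd p - 1" "ord p g > 0"
proof -
  have p: "\<not> p dvd g - 1" using lehmer_repunit_not_dvd_base_minus_1[OF g(1) lehmer assms] .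
  show iff: "p dvd repunit g m \<longleftrightarrow> ord p g dvd m" for m
    using prime_dvd_repunit_iff[OF g(1) assms(1) p] .
  show dvd: "ord p g dvd n" using iff assms by simp
  then show pos: "ord p g > 0" using n_ge_2 by (intro gr0I) auto
  then have "coprime p g" by simp
  then show "ord p g dvd p - 1"
    using order_divides_totient[of p g] assms by (simp add: totient_prime)
qed

lemma squarefree_repunit_dvd:
  assumes "u dvd n" shows "squarefree (repunit g u)"
  using repunit_dvd[OF g(1) assms] lehmer_squarefree[OF lehmer] squarefree_mono by blast

text \<open>The primes of \<open>repunit g u\<close> are not all those of \<open>N\<close>, and
  their product is below \<open>4 ^ (c * u)\<close>, so \<open>small_prime_factor\<close> gives a
  bounded prime \<open>p\<close> outside them. The order of \<open>g\<close> modulo \<open>p\<close>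
  serves as \<open>d\<close>: it does not divide \<open>u\<close>, as \<open>p\<close> does not
  divide \<open>repunit g u\<close>.\<close>

lemma small_order:
  assumes u: "u dvd n" "u < n"
  obtains d where "d dvd n" "\<not> d dvd u" "d > 0" "u * d \<le> order_bound c u"
proof -
  let ?S = "prime_factors (repunit g u)"
  have u1: "u \<ge> 1" using u by (cases u) auto
  have Ru: "repunit g u > 0" using repunit_pos g u1 by simp
  have S: "\<Prod>?S = repunit g u" by (intro squarefree_prod_prime_factors squarefree_repunit_dvd u)
  have "?S \<subseteq> prime_factors N"
    using repunit_dvd[OF g(1) u(1)] N_pos by (intro dvd_prime_factors) auto
  moreover have "?S \<noteq> prime_factors N"
    using S squarefree_prod_prime_factors[OF lehmer_squarefree[OF lehmer]]
      repunit_less_repunit[OF g(1) u(2)] by auto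
  ultimately have sub: "?S \<subset> prime_factors N" by blast
  have "\<Prod>?S + 1 \<le> g ^ u" using S repunit_less_power[OF g(1), of u] by simp
  also have "\<dots> \<le> (4 ^ c) ^ u" using base_le by (intro power_mono) auto
  also have "(4 ^ c) ^ u = (2 ^ (2 * c * u) :: nat)" by (simp add: power_mult)
  finally obtain p where p: "p \<in> prime_factors N" "p \<notin> ?S"
      "p \<le> 2 ^ (4 * c * (3 + 2 * c * u) + 2 * c * u)"
    using small_prime_factor[OF sub] by blast
  have prime: "prime p" "p dvd N" using p by (auto simp: in_prime_factors_iff)
  show ?thesis
  proof (rule that[of "ord p g"])
    show "ord p g dvd n" "ord p g > 0" using ord_dvd[OF prime] by auto
    show "\<not> ord p g dvd u"
      using ord_dvd(1)[OF prime, of u] p(2) prime Ru by (auto simp: in_prime_factors_iff)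
    have "ord p g \<le> p - 1" using ord_dvd(3)[OF prime] prime_gt_1_nat[OF prime(1)] by (intro dvd_imp_le) auto
    also have "\<dots> \<le> p" by simp
    also note p(3)
    finally have "u * ord p g \<le> 2 ^ u * 2 ^ (4 * c * (3 + 2 * c * u) + 2 * c * u)"
      using less_exp[of u] by (intro mult_le_mono) auto
    also have "\<dots> = 2 ^ (u + (4 * c * (3 + 2 * c * u) + 2 * c * u))" by (simp only: power_add)
    \<comment> \<open>The exponent expands into multiples of \<open>u\<close>, \<open>c\<close>,
      \<open>c * u\<close> and \<open>c * c * u\<close>, each at most \<open>c * c * u\<close>, with
      coefficients 1 + 12 + 2 + 8 = 23.\<close>
    also have "\<dots> \<le> 2 ^ (23 * c * c * u)"
    proof (intro power_increasing)
      have cc: "1 \<le> c * c" "c \<le> c * c" using c_pos by auto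
      have "1 * u \<le> c * c * u" "c * 1 \<le> c * c * u" "c * u \<le> c * c * u"
        using cc u1 by (intro mult_le_mono; simp)+
      moreover have "u + (4 * c * (3 + 2 * c * u) + 2 * c * u) = u + 12 * c + 8 * (c * c * u) + 2 * (c * u)"
        by (simp add: algebra_simps)
      moreover have "23 * c * c * u = 23 * (c * c * u)" by simp
      ultimately show "u + (4 * c * (3 + 2 * c * u) + 2 * c * u) \<le> 23 * c * c * u" by linarith
    qed simp
    finally show "u * ord p g \<le> order_bound c u" by (simp add: order_bound_def)
  qed
qed

section \<open>Prime factors modulo which the order of \<open>g\<close> is divisible by a given
  prime\<close>

definition primes_of_order :: "nat \<Rightarrow> nat set" where
  "primes_of_order q = {p \<in> prime_factors N. q dvd ord p g}"

text \<open>As \<open>q\<close> does not divide \<open>n - 1\<close>, the order of \<open>g\<close> modulo a power of \<open>q\<close> dividing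
  \<open>N - 1\<close> divides \<open>q - 1\<close>, so that this power is at most \<open>g ^ (q - 1)\<close>.\<close>

lemma card_primes_of_order:
  assumes q: "prime q" "q dvd n"
  shows "card (primes_of_order q) < g ^ q"
proof -
  define s where "s = card (primes_of_order q)"
  have q2: "q \<ge> 2" using q by (simp add: prime_ge_2_nat)
  have "q ^ s dvd N - 1" unfolding s_def
  proof (rule lehmer_power_dvd[OF lehmer])
    show "\<forall>p\<in>primes_of_order q. prime p \<and> p dvd N \<and> q dvd p - 1"
      using ord_dvd(3) by (auto simp: primes_of_order_def in_prime_factors_iff intro: dvd_trans)
  qed (simp add: primes_of_order_def)
  then have dvd: "q ^ s dvd g * repunit g (n - 1)"
    using repunit_minus_1[OF g(1), of n] n_ge_2 by simp
  have "q ^ s \<le> g ^ q"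
  proof (cases "q dvd g")
    case True
    obtain k where k: "n - 1 = Suc k" using n_ge_2 by (cases "n - 1") auto
    have "\<not> q dvd repunit g (n - 1)"
    proof
      assume "q dvd repunit g (n - 1)"
      then have "q dvd 1 + g * repunit g k" using k g by (simp add: repunit_Suc')
      then have "q dvd 1" using True by (metis dvd_add_left_iff dvd_mult2)
      then show False using q2 by simp
    qed
    then have "coprime (q ^ s) (repunit g (n - 1))" using q by (simp add: prime_imp_coprime)
    then have "q ^ s dvd g" using dvd by (simp add: coprime_dvd_mult_left_iff)
    then have "q ^ s \<le> g" using g by (intro dvd_imp_le) auto
    also have "g \<le> g ^ q" using g q2 by (intro self_le_power) auto
    finally show ?thesis .
  next
    case False
    show ?thesis
    \<comment> \<open>The formula \<open>q ^ (s - 1) * (q - 1)\<close> for the totient of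
      \<open>q ^ s\<close> holds only for positive \<open>s\<close>.\<close>
    proof (cases "s = 0")
      case True then show ?thesis using g by simp
    next
      case s: False
      let ?o = "ord (q ^ s) g"
      have cop: "coprime (q ^ s) g" using False q by (simp add: prime_imp_coprime)
      then have "q ^ s dvd repunit g (n - 1)" using dvd by (simp add: coprime_dvd_mult_right_iff)
      then have "q ^ s dvd (g - 1) * repunit g (n - 1)" by simp
      also have "(g - 1) * repunit g (n - 1) = g ^ (n - 1) - 1"
        using repunit_mult_base_minus_1[OF g(1), of "n - 1"] by simp
      finally have "[g ^ (n - 1) = 1] (mod q ^ s)" using g by (simp add: cong_altdef_nat)
      then have on: "?o dvd n - 1" by (simp only: ord_divides)
      have "\<not> q dvd ?o"
      proof
        assume "q dvd ?o"
        then have "q dvd n - 1" using on by (rule dvd_trans)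
        then have "q dvd n - (n - 1)" by (rule dvd_diff_nat[OF q(2)])
        then show False using n_ge_2 q2 by simp
      qed
      then have copo: "coprime ?o (q ^ (s - 1))"
        using q by (simp add: prime_imp_coprime coprime_commute)
      have "?o dvd q ^ (s - 1) * (q - 1)"
        using order_divides_totient[OF cop] s q by (simp add: totient_prime_power)
      then have "?o dvd q - 1" using copo by (simp add: coprime_dvd_mult_right_iff)
      then have "[g ^ (q - 1) = 1] (mod q ^ s)" by (simp only: ord_divides)
      then have "q ^ s dvd g ^ (q - 1) - 1" using g by (simp add: cong_altdef_nat)
      moreover have "g ^ (q - 1) > 1" using g q2 by (intro one_less_power) auto
      ultimately have "q ^ s \<le> g ^ (q - 1) - 1" by (intro dvd_imp_le) auto
      also have "\<dots> \<le> g ^ (q - 1)" by simp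
      also have "\<dots> \<le> g ^ q" using g by (intro power_increasing) auto
      finally show ?thesis .
    qed
  qed
  moreover have "s < q ^ s" using q2 less_exp[of s] power_mono[of 2 q s] by linarith
  ultimately show ?thesis by (simp add: s_def)
qed

text \<open>Prime factors of \<open>repunit g v\<close> whose order is prime to \<open>q\<close> divide \<open>repunit g w\<close> for the
  \<open>q\<close>-free part \<open>w\<close> of \<open>v\<close>, and \<open>repunit g u * repunit g w\<close> is too small to contain them all.\<close>

lemma new_prime_of_order:
  assumes q: "prime q" "q dvd u" and uv: "u dvd v" "u \<noteq> v" "v dvd n"
  obtains p where "p \<in> primes_of_order q" "p dvd repunit g v" "\<not> p dvd repunit g u"
proof -
  have v0: "v > 0" using uv n_ge_2 by (intro gr0I) auto
  then have u0: "u > 0" using uv by (intro gr0I) auto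
  \<comment> \<open>As \<open>v\<close> is odd, a proper divisor has cofactor at least 3. This gives
    \<open>u + w \<le> v - 1\<close> below, whereas cofactor 2 would only give
    \<open>u + w \<le> v\<close>.\<close>
  have triple: "3 * x \<le> v" if x: "x dvd v" "x \<noteq> v" for x
  proof -
    obtain k where k: "v = x * k" using x by (auto elim: dvdE)
    have "odd v" using odd_n uv(3) dvd_trans by blast
    then have "odd k" using k by simp
    moreover have "k \<noteq> 1" using k x by auto
    ultimately have "k \<ge> 3" by (cases "k = 0 \<or> k = 1 \<or> k = 2") auto
    then have "x * 3 \<le> x * k" by (rule mult_le_mono2)
    then show ?thesis using k by simp
  qed
  obtain w where w: "v = q ^ multiplicity q v * w" "\<not> q dvd w"
    using multiplicity_decompose'[of v q] v0 q by (metis not_prime_unit gr_implies_not_zero)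
  have "w \<noteq> v" using w(2) q uv(1) dvd_trans by blast
  moreover have wv: "w dvd v" using w(1) by (metis dvd_triv_right)
  ultimately have w3: "3 * w \<le> v" using triple by blast
  have u3: "3 * u \<le> v" using triple uv by blast
  have w0: "w > 0" using w v0 by (intro gr0I) auto
  have "\<exists>p\<in>prime_factors (repunit g v). \<not> p dvd repunit g u \<and> \<not> p dvd repunit g w"
  proof (rule ccontr)
    assume "\<not> ?thesis"
    then have "\<Prod>(prime_factors (repunit g v)) dvd repunit g u * repunit g w"
      by (intro prod_primes_dvd) (auto simp: in_prime_factors_iff)
    then have "repunit g v dvd repunit g u * repunit g w"
      using squarefree_prod_prime_factors[OF squarefree_repunit_dvd[OF uv(3)]] by simp
    moreover have "repunit g u * repunit g w > 0" using u0 w0 g repunit_pos by simp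
    ultimately have "repunit g v \<le> repunit g u * repunit g w" by (rule dvd_imp_le)
    also have "\<dots> \<le> g ^ u * repunit g w"
      using repunit_less_power[OF g(1), of u] by (intro mult_le_mono1) simp
    also have "\<dots> < g ^ u * g ^ w"
      using repunit_less_power[OF g(1), of w] g by (intro mult_strict_left_mono) auto
    also have "\<dots> \<le> g ^ (v - 1)" unfolding power_add[symmetric]
      using g u3 w3 u0 w0 by (intro power_increasing) auto
    also have "\<dots> \<le> repunit g v" using power_le_repunit[OF g(1), of v] v0 by simp
    finally show False by simp
  qed
  then obtain p where p: "prime p" "p dvd repunit g v" "\<not> p dvd repunit g u" "\<not> p dvd repunit g w"
    by (auto simp: in_prime_factors_iff)
  have pN: "p dvd N" using p(2) repunit_dvd[OF g(1) uv(3)] by (rule dvd_trans)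
  have "q dvd ord p g"
  proof (rule ccontr)
    assume "\<not> q dvd ord p g"
    then have "coprime (ord p g) (q ^ multiplicity q v)"
      using q by (simp add: prime_imp_coprime coprime_commute)
    moreover have "ord p g dvd q ^ multiplicity q v * w"
      using ord_dvd(1)[OF p(1) pN, of v] p(2) w(1) by simp
    ultimately have "ord p g dvd w" by (simp add: coprime_dvd_mult_right_iff)
    then show False using ord_dvd(1)[OF p(1) pN, of w] p(4) by simp
  qed
  then have "p \<in> primes_of_order q" using p pN N_pos by (simp add: primes_of_order_def in_prime_factors_iff)
  then show ?thesis using that p by blast
qed

text \<open>The chain starts at \<open>q\<close> and proceeds from \<open>u\<close> to
  \<open>lcm u d\<close> with \<open>d\<close> from \<open>small_order\<close>. By
  \<open>new_prime_of_order\<close> each step adds a prime to the counted set, until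
  \<open>n\<close> is reached and kept.\<close>

lemma divisor_chain:
  assumes q: "prime q" "q dvd n" "q \<le> order_bound c 1"
  shows "\<exists>u. u dvd n \<and> q dvd u \<and> u \<le> (order_bound c ^^ Suc j) 1 \<and>
    (u = n \<or> j \<le> card {p \<in> primes_of_order q. p dvd repunit g u})"
proof (induction j)
  case 0
  show ?case using q by (intro exI[of _ q]) auto
next
  case (Suc j)
  then obtain u where u: "u dvd n" "q dvd u" "u \<le> (order_bound c ^^ Suc j) 1"
    "u = n \<or> j \<le> card {p \<in> primes_of_order q. p dvd repunit g u}" by blast
  let ?Q = "\<lambda>u. {p \<in> primes_of_order q. p dvd repunit g u}"
  show ?case
  proof (cases "u = n")
    case True
    then show ?thesis
      using u q le_order_bound[OF c_pos, of "(order_bound c ^^ Suc j) 1"] by (intro exI[of _ n]) auto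
  next
    case False
    then have "u < n" using u n_ge_2 dvd_imp_le[of u n] by auto
    then obtain d where d: "d dvd n" "\<not> d dvd u" "d > 0" "u * d \<le> order_bound c u"
      using small_order[OF u(1)] by metis
    let ?v = "lcm u d"
    have v: "?v dvd n" using u d by simp
    have "u \<noteq> ?v" using d(2) by (metis dvd_lcm2)
    then obtain p where p: "p \<in> primes_of_order q" "p dvd repunit g ?v" "\<not> p dvd repunit g u"
      using new_prime_of_order[OF q(1) u(2) dvd_lcm1 _ v] by metis
    have "?Q u \<subset> ?Q ?v"
      using p repunit_dvd[OF g(1) dvd_lcm1[of u d]] by (auto intro: dvd_trans)
    moreover have "finite (?Q ?v)" by (simp add: primes_of_order_def)
    ultimately have "card (?Q u) < card (?Q ?v)" by (rule psubset_card_mono[rotated])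
    moreover have "j \<le> card (?Q u)" using u(4) False by simp
    ultimately have "Suc j \<le> card (?Q ?v)" by simp
    moreover have "?v \<le> (order_bound c ^^ Suc (Suc j)) 1"
    proof -
      have "u * d > 0" using d u n_ge_2 by (auto intro!: gr0I)
      then have "?v \<le> u * d" by (intro dvd_imp_le) (auto intro: lcm_least)
      also note d(4)
      also have "order_bound c u \<le> order_bound c ((order_bound c ^^ Suc j) 1)"
        using u(3) by (rule order_bound_mono)
      finally show ?thesis by simp
    qed
    moreover have "q dvd ?v" using u(2) by (rule dvd_trans) simp
    ultimately show ?thesis using v by blast
  qed
qed

lemma exponent_le: "n \<le> exponent_bound c"
proof -
  obtain d where d: "d dvd n" "\<not> d dvd 1" "d > 0" "1 * d \<le> order_bound c 1"
    using small_order[of 1] n_ge_2 by auto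
  obtain q where q: "prime q" "q dvd d" using d prime_factor_nat[of d] by auto
  have "q \<le> order_bound c 1" using dvd_imp_le[OF q(2) d(3)] d(4) by simp
  note q = q(1) dvd_trans[OF q(2) d(1)] this
  define s where "s = card (primes_of_order q)"
  \<comment> \<open>Only \<open>s\<close> primes are available, so a chain with \<open>Suc s\<close>
    steps must have reached \<open>n\<close>.\<close>
  obtain u where u: "u \<le> (order_bound c ^^ Suc (Suc s)) 1"
      "u = n \<or> Suc s \<le> card {p \<in> primes_of_order q. p dvd repunit g u}"
    using divisor_chain[OF q, of "Suc s"] by blast
  have "card {p \<in> primes_of_order q. p dvd repunit g u} \<le> s" unfolding s_def
    by (intro card_mono) (auto simp: primes_of_order_def)
  then have "n \<le> (order_bound c ^^ Suc (Suc s)) 1" using u by auto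
  also have "\<dots> \<le> (order_bound c ^^ ((4 ^ c) ^ order_bound c 1 + 1)) 1"
  proof -
    have "s < g ^ q" using card_primes_of_order[OF q(1,2)] by (simp add: s_def)
    also have "g ^ q \<le> (4 ^ c) ^ q" using base_le by (intro power_mono) auto
    also have "\<dots> \<le> (4 ^ c) ^ order_bound c 1" using q(3) by (intro power_increasing) auto
    finally have "Suc (Suc s) \<le> (4 ^ c) ^ order_bound c 1 + 1" by simp
    moreover have "(order_bound c ^^ i) 1 \<le> (order_bound c ^^ j) 1" if "i \<le> j" for i j
      using that
    proof (induction j rule: dec_induct)
      case (step j)
      then show ?case using le_order_bound[OF c_pos, of "(order_bound c ^^ j) 1"] by simp
    qed simp
    ultimately show ?thesis by blast
  qed
  finally show ?thesis by (simp add: exponent_bound_def)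
qed

lemma repunit_le: "N \<le> (4 ^ c) ^ exponent_bound c"
proof -
  have "N \<le> g ^ n" using repunit_less_power[OF g(1), of n] by simp
  also have "\<dots> \<le> (4 ^ c) ^ n" using base_le by (intro power_mono) auto
  also have "\<dots> \<le> (4 ^ c) ^ exponent_bound c" using exponent_le by (intro power_increasing) auto
  finally show ?thesis .
qed

end

subsection \<open>Computability of the bound\<close>

text \<open>Agreement is required only on lists of length \<open>k\<close>, so that functions may be
  written conveniently, whatever their values on other lists.\<close>

definition recursive_fun :: "nat \<Rightarrow> (nat list \<Rightarrow> nat) \<Rightarrow> bool" where
  "recursive_fun k f \<longleftrightarrow> (\<exists>F. general_recursive k F \<and> (\<forall>xs. length xs = k \<longrightarrow> f xs = F xs))"

lemma recursive_fun_proj: "i < k \<Longrightarrow> recursive_fun k (\<lambda>xs. xs ! i)"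
  unfolding recursive_fun_def by (blast intro: general_recursive.proj)

lemma recursive_fun_comp:
  assumes f: "recursive_fun (length gs) f" and gs: "\<forall>g\<in>set gs. recursive_fun k g"
  shows "recursive_fun k (\<lambda>xs. f (map (\<lambda>g. g xs) gs))"
proof -
  obtain F where F: "general_recursive (length gs) F" "\<forall>xs. length xs = length gs \<longrightarrow> f xs = F xs"
    using f by (auto simp: recursive_fun_def)
  have "\<forall>g\<in>set gs. \<exists>G. general_recursive k G \<and> (\<forall>xs. length xs = k \<longrightarrow> g xs = G xs)"
    using gs by (simp add: recursive_fun_def)
  then obtain G where G: "\<forall>g\<in>set gs. general_recursive k (G g) \<and> (\<forall>xs. length xs = k \<longrightarrow> g xs = G g xs)"
    by metis
  have "general_recursive k (\<lambda>xs. F (map (\<lambda>h. h xs) (map G gs)))"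
    using F G by (intro general_recursive.comp) auto
  moreover have "f (map (\<lambda>g. g xs) gs) = F (map (\<lambda>h. h xs) (map G gs))" if "length xs = k" for xs
  proof -
    have eq: "map (\<lambda>g. g xs) gs = map (\<lambda>h. h xs) (map G gs)" using G that by simp
    have "f (map (\<lambda>g. g xs) gs) = F (map (\<lambda>g. g xs) gs)" using F(2) by simp
    then show ?thesis by (simp only: eq)
  qed
  ultimately show ?thesis unfolding recursive_fun_def by blast
qed

lemma recursive_fun_Suc: "recursive_fun k f \<Longrightarrow> recursive_fun k (\<lambda>xs. Suc (f xs))"
proof -
  assume f: "recursive_fun k f"
  have "recursive_fun (length [f]) (\<lambda>xs. Suc (xs ! 0))"
    unfolding recursive_fun_def using general_recursive.succ by (auto intro!: exI)
  from recursive_fun_comp[OF this, of k] f show ?thesis by simp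
qed

lemma recursive_fun_const: "recursive_fun k (\<lambda>xs. c)"
proof (induction c)
  case 0
  then show ?case unfolding recursive_fun_def by (blast intro: general_recursive.zero)
qed (rule recursive_fun_Suc)

text \<open>In \<open>prim_rec\<close> the number of iterations is the head of the argument list.
  Composition with \<open>b\<close> and the projections lets it be any recursive function of the
  parameters.\<close>

lemma recursive_fun_rec_nat:
  assumes f: "recursive_fun k f" and h: "recursive_fun (Suc (Suc k)) h" and b: "recursive_fun k b"
  shows "recursive_fun k (\<lambda>xs. rec_nat (f xs) (\<lambda>m r. h (m # r # xs)) (b xs))"
proof -
  let ?R = "\<lambda>f h xs. rec_nat (f (tl xs)) (\<lambda>m r. h (m # r # tl xs)) (hd xs) :: nat"
  obtain F where F: "general_recursive k F" "\<forall>xs. length xs = k \<longrightarrow> f xs = F xs"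
    using f by (auto simp: recursive_fun_def)
  obtain H where H: "general_recursive (Suc (Suc k)) H" "\<forall>xs. length xs = Suc (Suc k) \<longrightarrow> h xs = H xs"
    using h by (auto simp: recursive_fun_def)
  have "?R f h xs = ?R F H xs" if "length xs = Suc k" for xs
  proof -
    have "rec_nat (f (tl xs)) (\<lambda>m r. h (m # r # tl xs)) i = rec_nat (F (tl xs)) (\<lambda>m r. H (m # r # tl xs)) i" for i
      using that F H by (induction i) auto
    then show ?thesis .
  qed
  then have rec: "recursive_fun (Suc k) (?R f h)"
    using general_recursive.prim_rec[OF F(1) H(1)] unfolding recursive_fun_def by blast
  define gs where "gs = b # map (\<lambda>i xs. xs ! i) [0..<k]"
  have "recursive_fun k (\<lambda>xs. ?R f h (map (\<lambda>g. g xs) gs))"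
  proof (rule recursive_fun_comp)
    show "recursive_fun (length gs) (?R f h)" using rec by (simp add: gs_def)
    show "\<forall>g\<in>set gs. recursive_fun k g" using b recursive_fun_proj by (auto simp: gs_def)
  qed
  moreover have "map (\<lambda>g. g xs) gs = b xs # xs" if "length xs = k" for xs
    using that map_nth[of xs] by (simp add: gs_def comp_def)
  ultimately show ?thesis unfolding recursive_fun_def by force
qed

lemma recursive_fun_add:
  assumes "recursive_fun k f" "recursive_fun k g" shows "recursive_fun k (\<lambda>xs. f xs + g xs)"
proof -
  have "rec_nat x (\<lambda>m r. Suc ((m # r # xs) ! 1)) y = x + y" for x y :: nat and xs
    by (induction y) auto
  then show ?thesis
    using recursive_fun_rec_nat[OF assms(1) recursive_fun_Suc[OF recursive_fun_proj[of 1]] assms(2)] by simp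
qed

text \<open>Inside a recursion the argument list is \<open>m # r # xs\<close>. Dropping the counter
  \<open>m\<close> and the accumulator \<open>r\<close> gives access to the parameters.\<close>

lemma recursive_fun_shift:
  assumes f: "recursive_fun k f" shows "recursive_fun (Suc (Suc k)) (\<lambda>xs. f (tl (tl xs)))"
proof -
  define gs :: "(nat list \<Rightarrow> nat) list" where "gs = map (\<lambda>i xs. xs ! Suc (Suc i)) [0..<k]"
  have "recursive_fun (Suc (Suc k)) (\<lambda>xs. f (map (\<lambda>g. g xs) gs))"
    using f recursive_fun_proj by (intro recursive_fun_comp) (auto simp: gs_def)
  moreover have "map (\<lambda>g. g xs) gs = tl (tl xs)" if "length xs = Suc (Suc k)" for xs
    using that by (intro nth_equalityI) (auto simp: gs_def nth_tl)
  ultimately show ?thesis unfolding recursive_fun_def by force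
qed

lemma recursive_fun_mult:
  assumes "recursive_fun k f" "recursive_fun k g" shows "recursive_fun k (\<lambda>xs. f xs * g xs)"
proof -
  have "rec_nat 0 (\<lambda>m r. (m # r # xs) ! 1 + f (tl (tl (m # r # xs)))) y = f xs * y" for y xs
    by (induction y) auto
  then show ?thesis
    using recursive_fun_rec_nat[OF recursive_fun_const[of k 0]
        recursive_fun_add[OF recursive_fun_proj[of 1] recursive_fun_shift[OF assms(1)]] assms(2)] by simp
qed

lemma recursive_fun_power:
  assumes "recursive_fun k f" "recursive_fun k g" shows "recursive_fun k (\<lambda>xs. f xs ^ g xs)"
proof -
  have "rec_nat 1 (\<lambda>m r. (m # r # xs) ! 1 * f (tl (tl (m # r # xs)))) y = f xs ^ y" for y xs
    by (induction y) auto
  then show ?thesis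
    using recursive_fun_rec_nat[OF recursive_fun_const[of k 1]
        recursive_fun_mult[OF recursive_fun_proj[of 1] recursive_fun_shift[OF assms(1)]] assms(2)] by simp
qed

lemma recursive_fun_order_bound:
  assumes "recursive_fun k c" "recursive_fun k u"
  shows "recursive_fun k (\<lambda>xs. order_bound (c xs) (u xs))"
  unfolding order_bound_def
  by (intro recursive_fun_power recursive_fun_mult recursive_fun_const assms)

lemma recursive_fun_exponent_bound:
  assumes c: "recursive_fun k c" shows "recursive_fun k (\<lambda>xs. exponent_bound (c xs))"
proof -
  have "rec_nat x (\<lambda>m r. order_bound (c (tl (tl (m # r # xs)))) ((m # r # xs) ! 1)) y =
      (order_bound (c xs) ^^ y) x" for x y xs
    by (induction y) auto
  then have iter: "recursive_fun k (\<lambda>xs. (order_bound (c xs) ^^ b xs) 1)" if "recursive_fun k b" for b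
    using recursive_fun_rec_nat[OF recursive_fun_const[of k 1]
        recursive_fun_order_bound[OF recursive_fun_shift[OF c] recursive_fun_proj[of 1]] that] by simp
  show ?thesis unfolding exponent_bound_def
    by (intro iter recursive_fun_add recursive_fun_power recursive_fun_order_bound
        recursive_fun_const c)
qed

section \<open>The final bound for both parities of the base\<close>

definition repunit_bound :: "nat \<Rightarrow> nat" where
  "repunit_bound l = (4 ^ 2 ^ l) ^ exponent_bound (2 ^ l)"

lemma computable_repunit_bound: "computable repunit_bound"
proof -
  have "recursive_fun 1 (\<lambda>xs. repunit_bound (xs ! 0))"
    unfolding repunit_bound_def
    by (intro recursive_fun_power recursive_fun_exponent_bound recursive_fun_const
        recursive_fun_proj zero_less_one)
  then obtain F where "general_recursive 1 F" "\<forall>xs. length xs = 1 \<longrightarrow> repunit_bound (xs ! 0) = F xs"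
    by (auto simp: recursive_fun_def)
  then have "repunit_bound x = F [x]" for x by (metis length_Cons list.size(3) nth_Cons_0 One_nat_def)
  with \<open>general_recursive 1 F\<close> show ?thesis unfolding computable_def by blast
qed

text \<open>Both valuations are at most \<open>l\<close>. For even \<open>g\<close> the bound
  \<open>4 ^ 2 ^ l\<close> already suffices, and for odd \<open>g\<close> the locale applies with
  \<open>c = 2 ^ l\<close>.\<close>

lemma lehmer_repunit_le:
  assumes g: "g \<ge> 2" and N: "lehmer (repunit g n)"
    and l: "multiplicity 2 g + multiplicity 2 (g + 1) \<le> l"
  shows "repunit g n \<le> repunit_bound l"
proof (cases "even g")
  case True
  have "1 \<le> (order_bound c ^^ i) 1" for c i
    by (induction i) (auto simp: order_bound_def)
  then have "1 \<le> exponent_bound (2 ^ l)" unfolding exponent_bound_def .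
  have "repunit g n \<le> 4 ^ 2 ^ multiplicity 2 g" using even_lehmer_repunit_bound[OF g True N] .
  also have "\<dots> \<le> 4 ^ 2 ^ l" using l by (intro power_increasing) auto
  also have "\<dots> \<le> (4 ^ 2 ^ l) ^ exponent_bound (2 ^ l)"
    using \<open>1 \<le> exponent_bound (2 ^ l)\<close> by (intro self_le_power) auto
  finally show ?thesis by (simp add: repunit_bound_def)
next
  case False
  interpret odd_lehmer_repunit g n "2 ^ l"
    using g False N l by unfold_locales (auto intro: power_increasing)
  show ?thesis using repunit_le by (simp add: repunit_bound_def)
qed

lemma repunit_set_lehmer_le:
  assumes "N \<in> repunit_set L" "lehmer N"
  shows "N \<le> repunit_bound (nat \<lfloor>L\<rfloor>)"
proof -
  obtain g n where gn: "N = repunit g n" "g \<ge> 2"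
      "real (multiplicity 2 g + multiplicity 2 (g + 1)) \<le> L"
    using assms(1) by (auto simp: repunit_set_def)
  have "multiplicity 2 g + multiplicity 2 (g + 1) \<le> nat \<lfloor>L\<rfloor>" using gn(3) by linarith
  then show ?thesis using lehmer_repunit_le gn assms(2) by blast
qed

text \<open>Membership in \<open>repunit_set L\<close> may be witnessed by a base and exponent other
  than \<open>g\<close> and \<open>n\<close>. Therefore the repunit is bounded first, and
  \<open>g\<close> and \<open>n\<close> are bounded by the repunit, with one function serving for
  both.\<close>

theorem corollary3p5:
  "(\<forall>L::real. L \<ge> 1 \<longrightarrow> finite {N \<in> repunit_set L. lehmer N}) \<and>
   (\<exists>Bg Bn :: nat \<Rightarrow> nat. computable Bg \<and> computable Bn \<and>
     (\<forall>L::real. L \<ge> 1 \<longrightarrow>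
       (\<forall>g n :: nat. g \<ge> 2 \<and> n \<ge> 1 \<and> repunit g n \<in> repunit_set L \<and> lehmer (repunit g n) \<longrightarrow>
          g \<le> Bg (nat \<lfloor>L\<rfloor>) \<and> n \<le> Bn (nat \<lfloor>L\<rfloor>))))"
proof (intro conjI allI impI exI[of _ repunit_bound] computable_repunit_bound)
  fix L :: real
  have "{N \<in> repunit_set L. lehmer N} \<subseteq> {..repunit_bound (nat \<lfloor>L\<rfloor>)}"
    using repunit_set_lehmer_le by blast
  then show "finite {N \<in> repunit_set L. lehmer N}" using finite_subset by blast
next
  fix L :: real and g n :: nat
  assume *: "g \<ge> 2 \<and> n \<ge> 1 \<and> repunit g n \<in> repunit_set L \<and> lehmer (repunit g n)"
  then have g: "g \<ge> 2" by blast
  \<comment> \<open>The exponent 1 gives the repunit 1 for every base, so only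
    \<open>n \<ge> 2\<close> makes \<open>g \<le> g ^ (n - 1)\<close> available.\<close>
  have n: "n \<ge> 2" using lehmer_repunit_ge_2 * by blast
  have le: "repunit g n \<le> repunit_bound (nat \<lfloor>L\<rfloor>)" using repunit_set_lehmer_le * by blast
  have step: "g ^ (n - 1) + repunit g (n - 1) = repunit g n"
    using repunit_Suc[OF g, of "n - 1"] n by simp
  have "g \<le> g ^ (n - 1)" using g n by (intro self_le_power) auto
  then show "g \<le> repunit_bound (nat \<lfloor>L\<rfloor>)" using le step by linarith
  have "n - 1 < 2 ^ (n - 1)" by (rule less_exp)
  also have "\<dots> \<le> g ^ (n - 1)" using g by (intro power_mono) auto
  finally show "n \<le> repunit_bound (nat \<lfloor>L\<rfloor>)" using le step by linarith
qed

end
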